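(* Let $f\in\mathcal F$, let $\beta'\in[0,2\pi)$ and $c'\in\mathbb R$. Let $h(\alpha)=f(\alpha+\beta')$ and define $g(\alpha)=\mathsf{RoC}(h)(\alpha)+c'$. Then $\psi_g(\alpha)=\psi_f(\alpha)$ for all $\alpha\in[0,2\pi]$.
   Context: $\mathcal F$ is the family of $2\pi$-periodic functions $f:\mathbb S^1\to\mathbb A\subset\mathbb R$ ($\mathbb A$ the real algebraic numbers). The reverse of complement of a $2\pi$-periodic function $h$ is $\mathsf{RoC}(h)(\theta)=M-h(2\pi-\theta)$, where $M\in\mathbb R$ is a fixed constant (any value is allowed). For a fixed function $\Phi:\mathbb R\to\mathbb R$ (e.g. $\Phi(z)=e^{-z}$, $e^{-|z|}$ or $e^{-z^2}$), and for a $2\pi$-periodic real function $f$, the sketch (signature) is $$\psi_f(\alpha)=\frac1{2\pi}\int_0^{2\pi}\Phi\big(f(\theta)-f(\theta+\alpha)\big)\,d\theta,$$ where functions are assumed to be such that the integrals exist. *)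

theory Defs
  imports "HOL-Analysis.Analysis" "HOL-Computational_Algebra.Polynomial" "HOL-Library.Periodic_Fun"
begin

text \<open>Functions on the circle are represented as \<open>2\<pi>\<close>-periodic functions on the real line.\<close>

definition periodic_alg_funs :: "(real \<Rightarrow> real) set" where
  "periodic_alg_funs = {f. periodic_fun_simple f (2 * pi) \<and> (\<forall>\<theta>. algebraic (f \<theta>))}"

definition RoC :: "real \<Rightarrow> (real \<Rightarrow> real) \<Rightarrow> real \<Rightarrow> real" where
  "RoC M h \<theta> = M - h (2 * pi - \<theta>)"

definition sketch_integrand :: "(real \<Rightarrow> real) \<Rightarrow> (real \<Rightarrow> real) \<Rightarrow> real \<Rightarrow> real \<Rightarrow> real" where
  "sketch_integrand \<Phi> f \<alpha> \<theta> = \<Phi> (f \<theta> - f (\<theta> + \<alpha>))"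

definition sketch :: "(real \<Rightarrow> real) \<Rightarrow> (real \<Rightarrow> real) \<Rightarrow> real \<Rightarrow> real" where
  "sketch \<Phi> f \<alpha> = 1 / (2 * pi) * (LINT \<theta>:{0..2 * pi}|lebesgue. sketch_integrand \<Phi> f \<alpha> \<theta>)"

text \<open>The Bochner integral of a non-integrable function is \<open>0\<close> by convention, so existence of the
  integrals defining the sketch on \<open>[0, 2\<pi>]\<close> is a separate condition.\<close>

definition sketch_exists :: "(real \<Rightarrow> real) \<Rightarrow> (real \<Rightarrow> real) \<Rightarrow> bool" where
  "sketch_exists \<Phi> f \<longleftrightarrow>
     (\<forall>\<alpha>\<in>{0..2 * pi}. set_integrable lebesgue {0..2 * pi} (sketch_integrand \<Phi> f \<alpha>))"

end

(* The integrand for g at theta is the integrand F for f at c - theta, where c = 2 pi - alpha + beta'.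
   F has period 2 pi, so c may be taken in [0, 2 pi]; then theta |-> c - theta reflects [0, c] onto
   itself and, modulo the period, reflects [c, 2 pi] onto itself, so the integral over a full period
   is unchanged. *)
theory Submission
  imports Defs
begin

text \<open>The substitution \<open>x\<close> to \<open>a + b - x\<close> has slope -1, hence
  scaling factor 1, and leaves the indicator of \<open>{a..b}\<close> invariant.\<close>

lemma set_lebesgue_integral_reflect_Icc:
  fixes F :: "real \<Rightarrow> 'a :: euclidean_space"
  shows "(LINT x:{a..b}|lebesgue. F (a + b - x)) = (LINT x:{a..b}|lebesgue. F x)"
proof -
  have [simp]: "indicator {a..b} (a + b - x) = (indicator {a..b} x :: real)" for x
    by (auto simp: indicator_def)
  show ?thesis
    using lebesgue_integral_real_affine[of "-1" "\<lambda>x. indicator {a..b} x *\<^sub>R F x" "a + b"]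
    by (simp add: set_lebesgue_integral_def)
qed

lemma set_integrable_lebesgue_reflect_Icc:
  fixes F :: "real \<Rightarrow> 'a :: euclidean_space"
  assumes "set_integrable lebesgue {a..b} F"
  shows "set_integrable lebesgue {a..b} (\<lambda>x. F (a + b - x))"
proof -
  have [simp]: "indicator {a..b} (a + b - x) = (indicator {a..b} x :: real)" for x
    by (auto simp: indicator_def)
  show ?thesis
    using assms lebesgue_integrable_real_affine[of "\<lambda>x. indicator {a..b} x *\<^sub>R F x" "-1" "a + b"]
    by (simp add: set_integrable_def)
qed

lemma periodic_set_lebesgue_integral_reflect:
  fixes F :: "real \<Rightarrow> 'a :: euclidean_space"
  assumes per: "periodic_fun_simple F p" and p: "p > 0"
    and int: "set_integrable lebesgue {0..p} F"
  shows "(LINT x:{0..p}|lebesgue. F (c - x)) = (LINT x:{0..p}|lebesgue. F x)"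
proof -
  interpret periodic_fun_simple F p by (fact per)
  \<comment> \<open>\<open>d\<close> is the representative of \<open>c\<close> modulo
    \<open>p\<close> in \<open>[0, p)\<close>; it is the point at which the period is cut.\<close>
  define d where "d = c - of_int \<lfloor>c / p\<rfloor> * p"
  have d: "0 \<le> d" "d \<le> p"
    using floor_divide_lower[OF p, of c] floor_divide_upper[OF p, of c]
    by (simp_all add: d_def algebra_simps)
  define G where "G x = F (c - x)" for x
  \<comment> \<open>The two forms of \<open>G\<close> differ by one period. Each has the shape
    \<open>a + b - x\<close> of the reflection lemmas, the first for \<open>{0..d}\<close> and the
    second for \<open>{d..p}\<close>.\<close>
  have G1: "G x = F (0 + d - x)" for x
    using minus_of_int[of "c - x" "\<lfloor>c / p\<rfloor>"] by (simp add: G_def d_def algebra_simps)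
  have G2: "G x = F (d + p - x)" for x
    using plus_1[of "d - x"] by (simp add: G1 algebra_simps)
  have F_int: "set_integrable lebesgue {0..d} F" "set_integrable lebesgue {d..p} F"
    using d by (auto intro: set_integrable_subset[OF int])
  have G_int: "set_integrable lebesgue {0..d} G" "set_integrable lebesgue {d..p} G"
    using F_int[THEN set_integrable_lebesgue_reflect_Icc]
    by (simp_all only: G1[symmetric] G2[symmetric])
  \<comment> \<open>Integrability of \<open>G\<close> over the full period is assembled from the two
    pieces, since only \<open>F\<close> is assumed integrable.\<close>
  have G_int': "set_integrable lebesgue {0..p} G"
    by (rule absolutely_integrable_on_combine[OF G_int d])
  have "(LINT x:{0..d}|lebesgue. G x) = (LINT x:{0..d}|lebesgue. F x)"
    unfolding G1 by (rule set_lebesgue_integral_reflect_Icc)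
  moreover have "(LINT x:{d..p}|lebesgue. G x) = (LINT x:{d..p}|lebesgue. F x)"
    unfolding G2 by (rule set_lebesgue_integral_reflect_Icc)
  \<comment> \<open>Both integrals are split at \<open>d\<close> as gauge integrals, where the
    shared endpoint does no harm; on integrable functions these agree with the Lebesgue
    integrals.\<close>
  ultimately have "integral {0..p} G = integral {0..p} F"
    using Henstock_Kurzweil_Integration.integral_combine[OF d set_lebesgue_integral_eq_integral(1)[OF int]]
      Henstock_Kurzweil_Integration.integral_combine[OF d set_lebesgue_integral_eq_integral(1)[OF G_int']]
    by (simp add: F_int G_int set_lebesgue_integral_eq_integral)
  then show ?thesis
    using int G_int' by (simp add: set_lebesgue_integral_eq_integral flip: G_def)
qed

theorem lemma3p2:
  fixes \<Phi> f h g :: "real \<Rightarrow> real" and M \<beta>' c' :: real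
  assumes "f \<in> periodic_alg_funs"
    and "sketch_exists \<Phi> f"
    and "\<beta>' \<in> {0..<2 * pi}"
    and "\<And>\<alpha>. h \<alpha> = f (\<alpha> + \<beta>')"
    and "\<And>\<alpha>. g \<alpha> = RoC M h \<alpha> + c'"
  shows "\<forall>\<alpha>\<in>{0..2 * pi}. sketch \<Phi> g \<alpha> = sketch \<Phi> f \<alpha>"
proof
  fix \<alpha> assume \<alpha>: "\<alpha> \<in> {0..2 * pi}"
  interpret f: periodic_fun_simple f "2 * pi"
    using assms(1) by (simp add: periodic_alg_funs_def)
  have per: "periodic_fun_simple (sketch_integrand \<Phi> f \<alpha>) (2 * pi)"
  proof
    fix \<theta>
    show "sketch_integrand \<Phi> f \<alpha> (\<theta> + 2 * pi) = sketch_integrand \<Phi> f \<alpha> \<theta>"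
      using f.plus_1[of \<theta>] f.plus_1[of "\<theta> + \<alpha>"] by (simp add: sketch_integrand_def algebra_simps)
  qed
  \<comment> \<open>In \<open>g \<theta> - g (\<theta> + \<alpha>)\<close> the constants
    \<open>M\<close> and \<open>c'\<close> cancel. The complement negates the difference and the
    reversal swaps its two sample points, so with
    \<open>u = 2 * pi - \<alpha> + \<beta>' - \<theta>\<close> it equals
    \<open>f u - f (u + \<alpha>)\<close>, sign included.\<close>
  have "sketch_integrand \<Phi> g \<alpha> \<theta> = sketch_integrand \<Phi> f \<alpha> (2 * pi - \<alpha> + \<beta>' - \<theta>)" for \<theta>
    by (simp add: sketch_integrand_def assms(4,5) RoC_def algebra_simps)
  moreover have "set_integrable lebesgue {0..2 * pi} (sketch_integrand \<Phi> f \<alpha>)"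
    using assms(2) \<alpha> by (simp add: sketch_exists_def)
  ultimately show "sketch \<Phi> g \<alpha> = sketch \<Phi> f \<alpha>"
    using periodic_set_lebesgue_integral_reflect[OF per] by (simp add: sketch_def)
qed

end
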